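(* Let $k\ge 2$, $m\ge 1$ and $\ell$ be integers and let $z$ be a nonzero complex number. Then the polynomial $$p_{m,k,z}(t)=\left(1+(-1)^{k(m-1)}z^k\right)-\sum_{i=1}^{k-1}z^i\,p_i(m,k,t,-1)$$ is the characteristic polynomial of the sequence $(A_n(k,m,\ell,z))_{n\ge 0}$, i.e. $p_{m,k,z}(N)A_n(k,m,\ell,z)=0$ for all integers $n\ge 0$.
   Context: For integers $n\ge 0$, $k\ge1$, $m\ge 1$, $\ell\in\mathbb{Z}$ and nonzero complex $z$, define $$A_n(k,m,\ell,z)=\sum_{h\in\mathbb{Z}}\binom{n}{\left\lfloor \frac{n+mh+\ell}{k}\right\rfloor}z^h,$$ where $\binom{n}{r}=0$ for $r<0$ or $r>n$ (so the sum is finite). Let $\alpha_1(x,s),\dots,\alpha_k(x,s)$ be the roots (in an algebraic closure of $\mathbb{Q}(x,s)$, counted with multiplicity) of the polynomial $w^k-xw^{k-1}-s$ in the variable $w$. Define $e_{i,k,m}(x,s)\in\mathbb{Z}[x,s]$ for $0\le i\le k$ by $$\prod_{j=1}^{k}\left(w-\alpha_j(x,s)^m\right)=\sum_{i=0}^{k}(-1)^i e_{i,k,m}(x,s)\,w^{k-i},$$ i.e. $e_{i,k,m}(x,s)$ is the $i$-th elementary symmetric polynomial of $\alpha_1^m,\dots,\alpha_k^m$. For $1\le i\le k-1$ put $p_i(m,k,x,s)=(-1)^{i+1}e_{i,k,m}(x,s)$. $N$ denotes the shift operator on sequences, $N^iA_n=A_{n+i}$; for a polynomial $p(t)=\sum_i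 c_it^i$ one has $p(N)A_n=\sum_i c_iA_{n+i}$. Convention: a polynomial $p(t)$ is called the characteristic polynomial of a sequence $(f(n))_{n\ge 0}$ if $p(N)f(n)=0$ for all $n\ge 0$ (no minimality of the degree is required). *)

theory Defs
  imports
    Complex_Main
    "HOL-Library.Groups_Big_Fun"
    "HOL-Computational_Algebra.Computational_Algebra"
    "HOL-Algebra.Algebraic_Closure_Type"
begin

text \<open>Binomial coefficients with an integer lower index, vanishing for \<open>r < 0\<close> and for \<open>r > n\<close>.\<close>

definition ibinom :: "nat \<Rightarrow> int \<Rightarrow> nat" where
  "ibinom n r = (if r < 0 then 0 else n choose nat r)"

text \<open>
  The sum over all integers \<open>h\<close> is the library's finite-support sum, which sums over those \<open>h\<close> where
  the summand is nonzero; for \<open>k, m \<ge> 1\<close> there are only finitely many of them.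
\<close>

definition A_seq :: "nat \<Rightarrow> nat \<Rightarrow> int \<Rightarrow> complex \<Rightarrow> nat \<Rightarrow> complex" where
  "A_seq k m l z n =
     Sum_any (\<lambda>h :: int.
       of_nat (ibinom n \<lfloor>real_of_int (int n + int m * h + l) / real k\<rfloor>) * z powi h)"

text \<open>
  The ring \<open>\<int>[x, s]\<close> is \<open>int poly poly\<close>, where the outer variable is \<open>s\<close> and the inner one (in the
  coefficients) is \<open>x\<close>. Its field of fractions is \<open>\<rat>(x, s)\<close>.
\<close>

type_synonym int_xs = "int poly poly"
type_synonym closure_xs = "int poly poly fract alg_closure"

definition var_x :: int_xs where "var_x = [:[:0, 1:]:]"

definition var_s :: int_xs where "var_s = [:0, 1:]"

definition emb :: "int_xs \<Rightarrow> closure_xs" where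
  "emb p = to_ac (to_fract p)"

definition alphas :: "nat \<Rightarrow> closure_xs multiset" where
  "alphas k =
     proots (Polynomial.monom 1 k - Polynomial.monom (emb var_x) (k - 1) - [:emb var_s:])"

text \<open>
  Uniqueness of \<open>e\<close> below is injectivity of the embedding. It exists for \<open>i \<le> k\<close> because symmetric
  integer polynomials in the roots of a monic polynomial over \<open>\<int>[x, s]\<close> have values in \<open>\<int>[x, s]\<close>.
\<close>

definition e_poly :: "nat \<Rightarrow> nat \<Rightarrow> nat \<Rightarrow> int_xs" where
  "e_poly i k m =
     (THE e. (-1) ^ i * emb e =
        Polynomial.coeff (\<Prod>\<alpha> \<in># alphas k. [:- (\<alpha> ^ m), 1:]) (k - i))"

definition p_poly :: "nat \<Rightarrow> nat \<Rightarrow> nat \<Rightarrow> int_xs" where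
  "p_poly i m k = (-1) ^ (i + 1) * e_poly i k m"

text \<open>Substituting a constant \<open>c\<close> for \<open>s\<close> leaves a polynomial in \<open>x\<close>, here taken over \<open>\<complex>\<close>.\<close>

definition subst_s :: "int_xs \<Rightarrow> int \<Rightarrow> complex poly" where
  "subst_s p c = map_poly of_int (poly p [:c:])"

definition p_mkz :: "nat \<Rightarrow> nat \<Rightarrow> complex \<Rightarrow> complex poly" where
  "p_mkz m k z =
     [:1 + (-1) ^ (k * (m - 1)) * z ^ k:]
       - (\<Sum>i = 1..k - 1. Polynomial.smult (z ^ i) (subst_s (p_poly i m k) (-1)))"

definition shift :: "(nat \<Rightarrow> 'a) \<Rightarrow> nat \<Rightarrow> 'a" where
  "shift f = (\<lambda>n. f (n + 1))"

definition apply_shift_poly :: "'a :: comm_ring_1 poly \<Rightarrow> (nat \<Rightarrow> 'a) \<Rightarrow> nat \<Rightarrow> 'a" where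
  "apply_shift_poly p f n =
     (\<Sum>i \<le> Polynomial.degree p. Polynomial.coeff p i * (shift ^^ i) f n)"

text \<open>No minimality of the degree is required.\<close>

definition is_char_poly :: "'a :: comm_ring_1 poly \<Rightarrow> (nat \<Rightarrow> 'a) \<Rightarrow> bool" where
  "is_char_poly p f \<longleftrightarrow> (\<forall>n. apply_shift_poly p f n = 0)"

end

theory Submission
  imports Defs "Jordan_Normal_Form.Char_Poly"
begin

text \<open>
  Write \<open>A n j\<close> for the sequence with \<open>l = j\<close> and \<open>E\<close> for the shift in \<open>j\<close>. Pascal's rule says
  \<open>N = E + E^(1 - k)\<close>, so \<open>E\<close> is a root of \<open>w^k - N w^(k - 1) + 1\<close>, the defining polynomial of the
  \<open>\<alpha>\<^sub>j\<close> at \<open>x = N\<close>, \<open>s = -1\<close>. Hence \<open>E^m\<close> is a root of \<open>\<Prod>(w - \<alpha>\<^sub>j^m)\<close>. But \<open>E^m\<close> acts as multiplication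
  by \<open>1/z\<close>, by reindexing the sum over \<open>h\<close>.

  That \<open>\<Prod>(w - \<alpha>\<^sub>j^m)\<close> has coefficients in \<open>\<int>[x, s]\<close> is seen by recognising it as the
  characteristic polynomial of the \<open>m\<close>-th power of a companion matrix; the \<open>\<alpha>\<^sub>j\<close> are distinct, so a
  Vandermonde matrix diagonalises it.
\<close>

section \<open>Polynomials in one and two variables acting by shifts\<close>

lemma apply_shift_poly_0 [simp]: "apply_shift_poly 0 f n = 0"
  by (simp add: apply_shift_poly_def)

lemma funpow_shift: "(shift ^^ i) f n = f (n + i)"
  by (induction i arbitrary: n) (simp_all add: shift_def)

lemma apply_shift_poly_pCons [simp]:
  "apply_shift_poly (pCons a p) f n = a * f n + apply_shift_poly p f (Suc n)"
proof (cases "p = 0")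
  case True
  then show ?thesis by (simp add: apply_shift_poly_def)
next
  case False
  then show ?thesis
    by (simp add: apply_shift_poly_def funpow_shift sum.atMost_Suc_shift del: sum.atMost_Suc)
qed

lemma apply_shift_poly_add:
  "apply_shift_poly (p + q) f n = apply_shift_poly p f n + apply_shift_poly q f n"
  by (induction p q arbitrary: n rule: poly_induct2) (simp_all add: algebra_simps)

lemma apply_shift_poly_smult:
  "apply_shift_poly (Polynomial.smult a p) f n = a * apply_shift_poly p f n"
  by (induction p arbitrary: n) (simp_all add: algebra_simps)

lemma apply_shift_poly_mult:
  "apply_shift_poly (p * q) f n = apply_shift_poly p (apply_shift_poly q f) n"
  by (induction p arbitrary: n) (simp_all add: apply_shift_poly_add apply_shift_poly_smult)

lemma apply_shift_poly_seq_zero [simp]: "apply_shift_poly p (\<lambda>n. 0) n = 0"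
  by (induction p arbitrary: n) simp_all

lemma apply_shift_poly_seq_add:
  "apply_shift_poly p (\<lambda>n. f n + g n) n = apply_shift_poly p f n + apply_shift_poly p g n"
  by (induction p arbitrary: n) (simp_all add: algebra_simps)

lemma apply_shift_poly_seq_scale:
  "apply_shift_poly p (\<lambda>n. c * f n) n = c * apply_shift_poly p f n"
  by (induction p arbitrary: n) (simp_all add: algebra_simps)

text \<open>
  A bivariate polynomial acts on arrays \<open>f n j\<close>: the inner variable shifts \<open>n\<close>, the outer one
  shifts \<open>j\<close>.
\<close>

definition act2 :: "'a :: comm_ring_1 poly poly \<Rightarrow> (nat \<Rightarrow> int \<Rightarrow> 'a) \<Rightarrow> nat \<Rightarrow> int \<Rightarrow> 'a" where
  "act2 P f n j =
     (\<Sum>i \<le> Polynomial.degree P. apply_shift_poly (Polynomial.coeff P i) (\<lambda>n. f n (j + int i)) n)"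

lemma act2_0 [simp]: "act2 0 f n j = 0"
  by (simp add: act2_def)

lemma act2_pCons [simp]:
  "act2 (pCons c P) f n j = apply_shift_poly c (\<lambda>n. f n j) n + act2 P f n (j + 1)"
proof (cases "P = 0")
  case True
  then show ?thesis by (simp add: act2_def)
next
  case False
  then show ?thesis
    by (simp add: act2_def sum.atMost_Suc_shift algebra_simps del: sum.atMost_Suc)
qed

lemma act2_add: "act2 (P + Q) f n j = act2 P f n j + act2 Q f n j"
  by (induction P Q arbitrary: j rule: poly_induct2)
     (simp_all add: algebra_simps apply_shift_poly_add)

lemma act2_smult:
  "act2 (Polynomial.smult c P) f n j = apply_shift_poly c (\<lambda>n. act2 P f n j) n"
  by (induction P arbitrary: j)
     (simp_all add: apply_shift_poly_mult apply_shift_poly_seq_add)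

lemma act2_monom: "act2 (Polynomial.monom c i) f n j = apply_shift_poly c (\<lambda>n. f n (j + int i)) n"
  by (induction i arbitrary: j) (simp_all add: monom_0 monom_Suc algebra_simps)

lemma act2_monom_1_mult: "act2 (Polynomial.monom 1 i * Q) f n j = act2 Q f n (j + int i)"
  by (induction i arbitrary: j) (simp_all add: monom_0 monom_Suc algebra_simps)

text \<open>The annihilators of an array form an ideal. Expanding the cofactor \<open>Q\<close>, not
  \<open>P\<close>, turns each term into a shift operator applied to \<open>act2 P f\<close>, which
  is zero.\<close>

lemma act2_dvd_zero:
  assumes "P dvd R" and "\<And>n j. act2 P f n j = 0"
  shows "act2 R f n j = 0"
proof -
  have "act2 (P * Q) f n j = 0" for Q
    by (induction Q arbitrary: j) (simp_all add: mult_pCons_right act2_add act2_smult assms(2))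
  with assms(1) show ?thesis by (auto elim!: dvdE)
qed

text \<open>Replacing \<open>w\<close> by \<open>w^m\<close> in \<open>P\<close> leaves only powers
  of the \<open>m\<close>-fold shift in \<open>j\<close>. That shift is multiplication by
  \<open>y\<close>, so the outer variable may be evaluated at the constant polynomial
  \<open>[:y:]\<close>.\<close>

lemma act2_pcompose_periodic:
  assumes "\<And>n j. f n (j + int m) = y * f n j"
  shows "act2 (pcompose P (Polynomial.monom 1 m)) f n j
    = apply_shift_poly (poly P [:y:]) (\<lambda>n. f n j) n"
proof (induction P arbitrary: j)
  case (pCons c P)
  have "act2 (pcompose (pCons c P) (Polynomial.monom 1 m)) f n j
      = apply_shift_poly c (\<lambda>n. f n j) n + act2 (pcompose P (Polynomial.monom 1 m)) f n (j + int m)"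
    by (simp add: pcompose_pCons act2_add act2_monom_1_mult)
  then show ?case
    using assms by (simp add: pCons.IH apply_shift_poly_add apply_shift_poly_smult
        apply_shift_poly_seq_scale)
qed simp

section \<open>Recurrence and quasi-periodicity of \<open>A_seq\<close>\<close>

lemma ibinom_Suc: "ibinom (Suc n) r = ibinom n r + ibinom n (r - 1)"
proof (cases "r \<le> 0")
  case False
  then have "nat r = Suc (nat (r - 1))" by simp
  with False show ?thesis by (simp add: ibinom_def)
qed (auto simp: ibinom_def)

lemma A_seq_eq:
  "A_seq k m l z n
    = Sum_any (\<lambda>h. of_nat (ibinom n ((int n + int m * h + l) div int k)) * z powi h)"
proof -
  have "\<lfloor>real_of_int a / real k\<rfloor> = a div int k" for a
    using floor_divide_of_int_eq[of a "int k"] by simp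
  then show ?thesis by (simp only: A_seq_def)
qed

text \<open>\<open>Sum_any\<close> is additive only on finite supports. A nonzero binomial
  coefficient forces the numerator to lie in \<open>[0, k * (n + 1))\<close>, which bounds
  \<open>m * h\<close> and hence \<open>h\<close>.\<close>

lemma finite_A_seq_support:
  assumes "k \<ge> 1" "m \<ge> 1"
  shows "finite {h. of_nat (ibinom n ((c + int m * h + l) div int k)) * z powi h \<noteq> (0 :: complex)}"
proof (rule finite_subset)
  let ?B = "int k * (int n + 1) + \<bar>c + l\<bar>"
  show "{h. of_nat (ibinom n ((c + int m * h + l) div int k)) * z powi h \<noteq> (0 :: complex)}
      \<subseteq> {- ?B .. ?B}"
  proof safe
    fix h
    let ?r = "(c + int m * h + l) div int k"
    assume "of_nat (ibinom n ?r) * z powi h \<noteq> (0 :: complex)"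
    then have nz: "ibinom n ?r \<noteq> 0" by auto
    then have r0: "0 \<le> ?r" by (simp add: ibinom_def split: if_splits)
    with nz have "n choose nat ?r \<noteq> 0" by (simp add: ibinom_def split: if_splits)
    then have "nat ?r \<le> n" by (metis binomial_eq_0 not_le)
    with r0 have r: "0 \<le> ?r" "?r \<le> int n" by linarith+
    have k: "int k > 0" using assms by simp
    have 1: "0 \<le> c + int m * h + l"
      using r(1) k by (simp add: pos_imp_zdiv_nonneg_iff)
    have "int k * ?r \<le> int k * int n"
      using r(2) by (intro mult_left_mono) auto
    moreover have "c + int m * h + l = int k * ?r + (c + int m * h + l) mod int k"
      by (rule mult_div_mod_eq[symmetric])
    ultimately have 2: "c + int m * h + l < int k * (int n + 1)"
      using pos_mod_bound[OF k, of "c + int m * h + l"] by (simp only: distrib_left mult_1_right)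
    have 3: "\<bar>h\<bar> \<le> int m * \<bar>h\<bar>" using assms(2) by (simp add: mult_le_cancel_right1)
    have "0 \<le> int k * (int n + 1)" using k by simp
    with 1 2 have "\<bar>int m * h\<bar> \<le> ?B" by linarith
    with 3 have "\<bar>h\<bar> \<le> ?B" by (simp add: abs_mult)
    then show "h \<in> {- ?B .. ?B}" by (auto simp: abs_le_iff)
  qed
qed simp

text \<open>Pascal's rule termwise: the increment of \<open>n\<close> is absorbed into
  \<open>l\<close>, and lowering the quotient by 1 amounts to lowering \<open>l\<close> by
  \<open>k\<close>.\<close>

lemma A_seq_Suc:
  assumes "k \<ge> 1" "m \<ge> 1"
  shows "A_seq k m l z (Suc n) = A_seq k m (l + 1) z n + A_seq k m (l + 1 - int k) z n"
proof -
  let ?f = "\<lambda>l h. of_nat (ibinom n ((int n + int m * h + l) div int k)) * z powi h :: complex"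
  have "of_nat (ibinom (Suc n) ((int (Suc n) + int m * h + l) div int k)) * z powi h
      = ?f (l + 1) h + ?f (l + 1 - int k) h" for h
  proof -
    let ?a = "int (Suc n) + int m * h + l"
    have "?a = (int n + int m * h + (l + 1 - int k)) + int k * 1" by simp
    then have "?a div int k = ((int n + int m * h + (l + 1 - int k)) + int k * 1) div int k"
      by (rule arg_cong)
    also have "\<dots> = 1 + (int n + int m * h + (l + 1 - int k)) div int k"
      by (rule div_mult_self2) (use assms in simp)
    finally have "?a div int k = 1 + (int n + int m * h + (l + 1 - int k)) div int k" .
    then have "?a div int k - 1 = (int n + int m * h + (l + 1 - int k)) div int k" by simp
    moreover have "?a = int n + int m * h + (l + 1)" by simp
    ultimately show ?thesis by (simp only: ibinom_Suc of_nat_add distrib_right)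
  qed
  then have "A_seq k m l z (Suc n) = Sum_any (\<lambda>h. ?f (l + 1) h + ?f (l + 1 - int k) h)"
    unfolding A_seq_eq by (rule Sum_any.cong)
  also have "\<dots> = Sum_any (?f (l + 1)) + Sum_any (?f (l + 1 - int k))"
    by (intro Sum_any.distrib finite_A_seq_support assms)
  finally show ?thesis unfolding A_seq_eq .
qed

text \<open>Adding \<open>m\<close> to \<open>l\<close> has the same effect on the binomial as
  replacing \<open>h\<close> by \<open>h + 1\<close>; the factor \<open>inverse z\<close> corrects
  the power of \<open>z\<close>.\<close>

lemma A_seq_periodic:
  assumes "k \<ge> 1" "m \<ge> 1" "z \<noteq> 0"
  shows "A_seq k m (l + int m) z n = inverse z * A_seq k m l z n"
proof -
  let ?f = "\<lambda>h. of_nat (ibinom n ((int n + int m * h + l) div int k)) * z powi h"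
  have "of_nat (ibinom n ((int n + int m * h + (l + int m)) div int k)) * z powi h
      = inverse z * ?f (h + 1)" for h
  proof -
    have 1: "int n + int m * h + (l + int m) = int n + int m * (h + 1) + l"
      by (simp add: algebra_simps)
    have 2: "z powi h = inverse z * z powi (h + 1)"
      using assms(3) by (simp add: power_int_add)
    show ?thesis unfolding 1 2 by (rule mult.left_commute)
  qed
  then have "A_seq k m (l + int m) z n = Sum_any (\<lambda>h. inverse z * ?f (h + 1))"
    unfolding A_seq_eq by (rule Sum_any.cong)
  also have "\<dots> = inverse z * Sum_any (\<lambda>h. ?f (h + 1))"
  proof (rule Sum_any_right_distrib[symmetric])
    have "{h. ?f (h + 1) \<noteq> 0} \<subseteq> (\<lambda>h. h - 1) ` {h. ?f h \<noteq> 0}"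
    proof
      fix h assume "h \<in> {h. ?f (h + 1) \<noteq> 0}"
      then show "h \<in> (\<lambda>h. h - 1) ` {h. ?f h \<noteq> 0}" by (intro image_eqI[of _ _ "h + 1"]) auto
    qed
    then show "finite {h. ?f (h + 1) \<noteq> 0}"
      by (rule finite_subset) (intro finite_imageI finite_A_seq_support assms)
  qed
  also have "Sum_any (\<lambda>h. ?f (h + 1)) = Sum_any ?f"
  proof (rule Sum_any.reindex_cong[of "\<lambda>h. h + 1" ?f "\<lambda>h. ?f (h + 1)", symmetric])
    show "bij (\<lambda>h :: int. h + 1)" by (rule o_bij[of "\<lambda>h. h - 1"]) auto
  qed auto
  finally show ?thesis unfolding A_seq_eq .
qed

section \<open>The defining polynomial of the roots and its separability\<close>

interpretation emb: inj_idom_hom emb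
  by unfold_locales (auto simp: emb_def)

interpretation emb_poly: map_poly_inj_idom_hom emb ..

lemma ring_hom_subst_s: "comm_ring_hom (\<lambda>p. subst_s p c)"
proof -
  interpret of_int: comm_ring_hom "of_int :: int \<Rightarrow> complex" by unfold_locales auto
  interpret P: map_poly_comm_ring_hom "of_int :: int \<Rightarrow> complex" ..
  show ?thesis by unfold_locales (auto simp: subst_s_def hom_distribs)
qed

text \<open>Kept over \<int>[x, s], so that it can be both embedded into the algebraic closure and
  specialised at \<open>s = -1\<close>.\<close>

definition trinomial :: "nat \<Rightarrow> int_xs poly" where
  "trinomial k = Polynomial.monom 1 k - Polynomial.monom var_x (k - 1) - [:var_s:]"

lemma degree_trinomial:
  assumes "k \<ge> 2"
  shows "Polynomial.degree (trinomial k) = k" "Polynomial.lead_coeff (trinomial k) = 1"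
proof -
  have c: "Polynomial.coeff (trinomial k) k = 1"
    using assms by (simp add: trinomial_def coeff_pCons split: nat.split)
  have "Polynomial.degree (trinomial k) \<le> k"
    unfolding trinomial_def
    by (intro degree_diff_le) (use assms in \<open>auto intro: order_trans[OF degree_monom_le]\<close>)
  moreover have "k \<le> Polynomial.degree (trinomial k)" by (rule le_degree) (simp add: c)
  ultimately show "Polynomial.degree (trinomial k) = k" by simp
  with c show "Polynomial.lead_coeff (trinomial k) = 1" by simp
qed

lemma map_poly_emb_trinomial:
  "map_poly emb (trinomial k)
    = Polynomial.monom 1 k - Polynomial.monom (emb var_x) (k - 1) - [:emb var_s:]"
  by (simp add: trinomial_def hom_distribs)

lemma alphas_eq: "alphas k = proots (map_poly emb (trinomial k))"
  by (simp add: alphas_def map_poly_emb_trinomial)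

lemma proots_prod_linear_factors: "proots (\<Prod>a\<in>#A. [:-a, 1:]) = A"
  by (induction A) (simp_all add: proots_mult prod_mset_zero_iff image_iff del: mult_pCons_left)

text \<open>The algebraic closure splits the monic trinomial into linear factors, and
  \<open>proots\<close> recovers their multiset.\<close>

lemma prod_alphas:
  assumes "k \<ge> 2"
  shows "(\<Prod>\<alpha>\<in>#alphas k. [:-\<alpha>, 1:]) = map_poly emb (trinomial k)" "size (alphas k) = k"
proof -
  have d: "Polynomial.degree (map_poly emb (trinomial k)) = k"
    using degree_trinomial[OF assms] by simp
  have lc: "Polynomial.lead_coeff (map_poly emb (trinomial k)) = 1"
    using degree_trinomial[OF assms] by simp
  then have nz: "map_poly emb (trinomial k) \<noteq> 0" by auto
  obtain A where A: "size A = k"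
    "map_poly emb (trinomial k) = (\<Prod>\<alpha>\<in>#A. [:-\<alpha>, 1:])"
    using alg_closed_imp_factorization[OF nz] lc d by auto
  have "alphas k = A" unfolding alphas_eq A(2) by (rule proots_prod_linear_factors)
  with A show "(\<Prod>\<alpha>\<in>#alphas k. [:-\<alpha>, 1:]) = map_poly emb (trinomial k)" "size (alphas k) = k"
    by auto
qed

lemma trinomial_root:
  assumes "poly (map_poly emb (trinomial k)) a = 0"
  shows "a ^ k = emb var_x * a ^ (k - 1) + emb var_s"
  using assms by (simp add: map_poly_emb_trinomial poly_monom algebra_simps)

text \<open>
  Up to sign and a power of \<open>s\<close>, this is the discriminant: a double root \<open>a\<close> satisfies
  \<open>k a = (k - 1) x\<close>, and substituting this into the equation gives the expression below.
\<close>

lemma discriminant_nonzero: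
  assumes "k \<ge> 2"
  shows "of_nat (k ^ k) * var_s + of_nat ((k - 1) ^ (k - 1)) * var_x ^ k \<noteq> 0"
proof
  assume "of_nat (k ^ k) * var_s + of_nat ((k - 1) ^ (k - 1)) * var_x ^ k = 0"
  \<comment> \<open>The outer variable is \<open>s\<close>; setting it to 0 leaves a nonzero
    multiple of \<open>x^k\<close>.\<close>
  then have "poly (of_nat (k ^ k) * var_s + of_nat ((k - 1) ^ (k - 1)) * var_x ^ k) 0 = 0"
    by simp
  then show False using assms by (simp add: var_x_def var_s_def)
qed

lemma order_trinomial_le_1:
  assumes "k \<ge> 2"
  shows "Polynomial.order a (map_poly emb (trinomial k)) \<le> 1"
proof (rule ccontr)
  let ?p = "map_poly emb (trinomial k)"
  assume "\<not> ?thesis"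
  then have "[:-a, 1:] ^ 2 dvd ?p"
    by (simp add: order_divides)
  then obtain q where q: "?p = [:-a, 1:] ^ 2 * q" by (elim dvdE)
  have 0: "poly ?p a = 0" unfolding q by simp
  have 1: "poly (pderiv ?p) a = 0" 
    unfolding q power2_eq_square by (simp only: pderiv_mult poly_add poly_mult) simp
  obtain i where k: "k = Suc (Suc i)" using le_Suc_ex[OF assms] by auto
  let ?x = "emb var_x" and ?s = "emb var_s"
  have root: "a ^ Suc (Suc i) = ?x * a ^ Suc i + ?s" using trinomial_root[OF 0] by (simp add: k)
  \<comment> \<open>This permits cancelling \<open>a ^ i\<close>, with \<open>i = k - 2\<close>,
    from the vanishing derivative, which leaves \<open>k a = (k - 1) x\<close>.\<close>
  have "a \<noteq> 0"
  proof
    assume "a = 0"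
    with root have "?s = 0" by simp
    then show False by (simp add: var_s_def)
  qed
  moreover have "of_nat (Suc (Suc i)) * a ^ Suc i = of_nat (Suc i) * ?x * a ^ i"
    using 1 by (simp add: map_poly_emb_trinomial k pderiv_diff pderiv_monom poly_monom pderiv_pCons)
  ultimately have d: "of_nat k * a = of_nat (k - 1) * ?x" by (simp add: k)
  \<comment> \<open>The equation reads \<open>s = a^(k - 1) * (a - x)\<close>. Scaling by
    \<open>k^k\<close> attaches a factor \<open>k\<close> to every \<open>a\<close>, so that
    \<open>a\<close> can be eliminated.\<close>
  have "of_nat (k ^ k) * ?s = (of_nat k * a) ^ (k - 1) * (of_nat k * a - of_nat k * ?x)"
  proof -
    have "?s = a ^ (k - 1) * (a - ?x)" using root by (simp add: k algebra_simps)
    moreover have "of_nat (k ^ k) = of_nat k ^ (k - 1) * (of_nat k :: closure_xs)"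
      using assms by (simp add: power_minus_mult del: One_nat_def)
    ultimately show ?thesis
      by (simp only: power_mult_distrib right_diff_distrib[symmetric]) (simp only: mult_ac)
  qed
  also have "\<dots> = (of_nat (k - 1) * ?x) ^ (k - 1) * (- ?x)"
    unfolding d by (simp add: k algebra_simps)
  also have "\<dots> = - (of_nat ((k - 1) ^ (k - 1)) * ?x ^ k)"
  proof -
    have "?x ^ k = ?x ^ (k - 1) * ?x"
      using assms by (simp add: power_minus_mult del: One_nat_def)
    then show ?thesis
      by (simp only: of_nat_power power_mult_distrib mult_minus_right mult.assoc)
  qed
  finally have "emb (of_nat (k ^ k) * var_s + of_nat ((k - 1) ^ (k - 1)) * var_x ^ k) = 0"
    by (simp add: hom_distribs)
  then show False using discriminant_nonzero[OF assms] by simp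
qed

text \<open>An ordering of the roots is fixed here to index matrix columns; distinctness will make
  the Vandermonde matrix invertible.\<close>

lemma distinct_roots_list:
  assumes "k \<ge> 2"
  obtains as where "mset as = alphas k" "length as = k" "distinct as"
    "\<And>i. i < k \<Longrightarrow> (as ! i) ^ k = emb var_x * (as ! i) ^ (k - 1) + emb var_s"
proof -
  obtain as where as: "mset as = alphas k" using ex_mset by blast
  have nz: "trinomial k \<noteq> 0" using degree_trinomial[OF assms] by auto
  have "length as = k" using prod_alphas(2)[OF assms] as by (metis size_mset)
  moreover have "distinct as"
    unfolding distinct_count_atmost_1 as
  proof (intro allI)
    fix a
    have "count (alphas k) a \<le> 1"
      using order_trinomial_le_1[OF assms, of a] nz by (simp add: alphas_eq)
    then show "count (alphas k) a = (if a \<in> set as then 1 else 0)"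
      using as by (metis One_nat_def count_mset_0_iff le_Suc_eq le_zero_eq)
  qed
  moreover have "(as ! i) ^ k = emb var_x * (as ! i) ^ (k - 1) + emb var_s" if "i < k" for i
  proof (rule trinomial_root)
    have "as ! i \<in># alphas k" using that \<open>length as = k\<close> by (simp flip: as)
    then show "poly (map_poly emb (trinomial k)) (as ! i) = 0"
      using nz by (simp add: alphas_eq)
  qed
  ultimately show thesis using as that by blast
qed

section \<open>Diagonalising the companion matrix\<close>

text \<open>The last row is \<open>(s, 0, ..., 0, x)\<close>, so for each root \<open>a\<close> the
  column \<open>(1, a, ..., a^(k - 1))\<close> is an eigenvector with eigenvalue \<open>a\<close>.
  These columns form \<open>vandermonde\<close>.\<close>

definition companion :: "nat \<Rightarrow> int_xs mat" where
  "companion k = mat k k (\<lambda>(i, j). if Suc i < k then (if j = Suc i then 1 else 0)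
     else (if j = 0 then var_s else 0) + (if j = k - 1 then var_x else 0))"

definition vandermonde :: "'a :: comm_ring_1 list \<Rightarrow> 'a mat" where
  "vandermonde as = mat (length as) (length as) (\<lambda>(i, j). (as ! j) ^ i)"

definition diagonal :: "'a :: comm_ring_1 list \<Rightarrow> 'a mat" where
  "diagonal as = mat (length as) (length as) (\<lambda>(i, j). if i = j then as ! i else 0)"

lemma companion_carrier [simp]: "companion k \<in> carrier_mat k k"
  by (simp add: companion_def)

lemma vandermonde_carrier [simp]: "vandermonde as \<in> carrier_mat (length as) (length as)"
  by (simp add: vandermonde_def)

lemma diagonal_carrier [simp]: "diagonal as \<in> carrier_mat (length as) (length as)"
  by (simp add: diagonal_def)

lemma mult_diagonal_index:
  assumes "A \<in> carrier_mat n (length as)" "i < n" "j < length as"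
  shows "(A * diagonal as) $$ (i, j) = A $$ (i, j) * as ! j"
proof -
  have "(A * diagonal as) $$ (i, j)
      = (\<Sum>l = 0..<length as. A $$ (i, l) * (if l = j then as ! l else 0))"
    using assms by (auto simp: scalar_prod_def diagonal_def intro!: sum.cong)
  also have "\<dots> = (\<Sum>l = 0..<length as. if l = j then A $$ (i, l) * as ! l else 0)"
    by (intro sum.cong) auto
  also have "\<dots> = A $$ (i, j) * as ! j" using assms by simp
  finally show ?thesis .
qed

lemma companion_vandermonde:
  assumes "length as = k" "k \<ge> 2"
    and "\<And>i. i < k \<Longrightarrow> (as ! i) ^ k = emb var_x * (as ! i) ^ (k - 1) + emb var_s"
  shows "map_mat emb (companion k) * vandermonde as = vandermonde as * diagonal as"
proof (rule eq_matI)
  fix i j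
  assume "i < dim_row (vandermonde as * diagonal as)" "j < dim_col (vandermonde as * diagonal as)"
  then have ij: "i < k" "j < k" using assms(1) by (auto simp: vandermonde_def diagonal_def)
  let ?a = "as ! j"
  have "(map_mat emb (companion k) * vandermonde as) $$ (i, j)
      = (\<Sum>l = 0..<k. emb (companion k $$ (i, l)) * ?a ^ l)"
    using ij assms(1) by (simp add: scalar_prod_def vandermonde_def companion_def)
  also have "\<dots> = ?a ^ Suc i"
  proof (cases "Suc i < k")
    case True
    have "(\<Sum>l = 0..<k. emb (companion k $$ (i, l)) * ?a ^ l)
        = (\<Sum>l = 0..<k. if l = Suc i then ?a ^ l else 0)"
      using ij True by (intro sum.cong) (auto simp: companion_def)
    then show ?thesis using True by simp
  next
    case False
    have "(\<Sum>l = 0..<k. emb (companion k $$ (i, l)) * ?a ^ l)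
        = (\<Sum>l = 0..<k. (if l = 0 then emb var_s else 0) + (if l = k - 1 then emb var_x * ?a ^ l else 0))"
      using ij False assms(2) by (intro sum.cong) (auto simp: companion_def hom_distribs)
    also have "\<dots> = emb var_s + emb var_x * ?a ^ (k - 1)"
      using assms(2) by (simp add: sum.distrib)
    \<comment> \<open>Only the last row uses that \<open>?a\<close> is a root of the
      trinomial.\<close>
    also have "\<dots> = ?a ^ k" using assms(3)[OF ij(2)] by simp
    also have "?a ^ k = ?a ^ Suc i"
    proof -
      have "k = Suc i" using ij False by simp
      then show ?thesis by simp
    qed
    finally show ?thesis .
  qed
  also have "\<dots> = (vandermonde as * diagonal as) $$ (i, j)"
    using ij assms(1) by (subst mult_diagonal_index) (auto simp: vandermonde_def)
  finally show "(map_mat emb (companion k) * vandermonde as) $$ (i, j)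
      = (vandermonde as * diagonal as) $$ (i, j)" .
qed (use assms(1) in \<open>auto simp: vandermonde_def diagonal_def companion_def\<close>)

lemma diagonal_mult_map:
  "diagonal (map f as) * diagonal as = diagonal (map (\<lambda>a. f a * a) as)"
proof (rule eq_matI)
  fix i j
  assume "i < dim_row (diagonal (map (\<lambda>a. f a * a) as))" "j < dim_col (diagonal (map (\<lambda>a. f a * a) as))"
  then have ij: "i < length as" "j < length as" by (auto simp: diagonal_def)
  have "diagonal (map f as) \<in> carrier_mat (length as) (length as)"
    using diagonal_carrier[of "map f as"] by simp
  from mult_diagonal_index[OF this ij]
  show "(diagonal (map f as) * diagonal as) $$ (i, j) = diagonal (map (\<lambda>a. f a * a) as) $$ (i, j)"
    using ij by (simp add: diagonal_def)
qed (auto simp: diagonal_def)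

lemma pow_mat_vandermonde:
  assumes "A \<in> carrier_mat (length as) (length as)"
    and "A * vandermonde as = vandermonde as * diagonal as"
  shows "A ^\<^sub>m m * vandermonde as = vandermonde as * diagonal (map (\<lambda>a. a ^ m) as)"
proof (induction m)
  case 0
  have "diagonal (map (\<lambda>a. a ^ 0) as) = 1\<^sub>m (length as)"
    by (rule eq_matI) (auto simp: diagonal_def)
  then show ?case using assms(1) left_mult_one_mat[OF vandermonde_carrier[of as]]
      right_mult_one_mat[OF vandermonde_carrier[of as]]
    by simp
next
  case (Suc m)
  let ?n = "length as" and ?V = "vandermonde as" and ?D = "diagonal (map (\<lambda>a. a ^ m) as)"
  have D: "?D \<in> carrier_mat ?n ?n" using diagonal_carrier[of "map (\<lambda>a. a ^ m) as"] by simp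
  have P: "A ^\<^sub>m m \<in> carrier_mat ?n ?n" using assms(1) by simp
  have "A ^\<^sub>m Suc m * ?V = A ^\<^sub>m m * (A * ?V)"
    using assoc_mult_mat[OF P assms(1) vandermonde_carrier] by simp
  also have "\<dots> = A ^\<^sub>m m * ?V * diagonal as"
    unfolding assms(2) by (rule assoc_mult_mat[OF P vandermonde_carrier diagonal_carrier, symmetric])
  also have "\<dots> = ?V * (?D * diagonal as)"
    unfolding Suc.IH by (rule assoc_mult_mat[OF vandermonde_carrier D diagonal_carrier])
  also have "?D * diagonal as = diagonal (map (\<lambda>a. a ^ Suc m) as)"
    by (simp add: diagonal_mult_map mult.commute)
  finally show ?case .
qed

text \<open>A kernel vector of the transpose lists the coefficients of a polynomial of degree less
  than \<open>length as\<close> that vanishes on all of \<open>as\<close>; with distinct entries it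
  must be zero.\<close>

lemma det_vandermonde_nonzero:
  fixes as :: "'a :: field list"
  assumes "distinct as"
  shows "det (vandermonde as) \<noteq> 0"
proof
  let ?n = "length as"
  assume "det (vandermonde as) = 0"
  then have "det ((vandermonde as)\<^sup>T) = 0" by (simp add: det_transpose[OF vandermonde_carrier])
  then obtain v where v: "v \<in> carrier_vec ?n" "v \<noteq> 0\<^sub>v ?n" "(vandermonde as)\<^sup>T *\<^sub>v v = 0\<^sub>v ?n"
    by (subst (asm) det_0_iff_vec_prod_zero_field[of _ ?n]) auto
  let ?p = "\<Sum>i<?n. Polynomial.monom (v $ i) i"
  have coeff: "Polynomial.coeff ?p i = (if i < ?n then v $ i else 0)" for i
    by (simp add: coeff_sum)
  have "?p = 0"
  proof (cases "?n = 0")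
    case False
    have deg: "Polynomial.degree ?p < ?n"
      using False by (intro degree_lessI) (auto simp: coeff)
    show ?thesis
    proof (rule poly_eqI_degree[where A = "set as"])
      fix a assume "a \<in> set as"
      then obtain j where j: "j < ?n" "a = as ! j" by (metis in_set_conv_nth)
      have "((vandermonde as)\<^sup>T *\<^sub>v v) $ j = 0" using v(3) j by simp
      moreover have "((vandermonde as)\<^sup>T *\<^sub>v v) $ j = (\<Sum>i = 0..<?n. a ^ i * v $ i)"
        using j v(1) by (simp add: scalar_prod_def vandermonde_def)
      ultimately show "poly ?p a = poly 0 a"
        by (simp add: poly_sum poly_monom atLeast0LessThan mult.commute)
    qed (use deg assms False in \<open>auto simp: distinct_card\<close>)
  qed simp
  have "v $ i = 0" if "i < ?n" for i
    using coeff[of i] that unfolding \<open>?p = 0\<close> by simp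
  then have "v = 0\<^sub>v ?n" using v(1) by (intro eq_vecI) auto
  with v(2) show False by simp
qed

lemma similar_matI_intertwined:
  fixes A B V :: "'a :: field mat"
  assumes [simp]: "A \<in> carrier_mat n n" "B \<in> carrier_mat n n" "V \<in> carrier_mat n n"
    and "det V \<noteq> 0" "A * V = V * B"
  shows "similar_mat A B"
proof -
  obtain W where W: "W \<in> carrier_mat n n" "V * W = 1\<^sub>m n" "W * V = 1\<^sub>m n"
    \<comment> \<open>The argument \<open>()\<close> merely fills the extension slot of the matrix
      ring record.\<close>
    using det_non_zero_imp_unit[OF assms(3,4), of "()"] by (auto simp: Units_def ring_mat_simps)
  have "A = A * (V * W)" using W(2) right_mult_one_mat[OF assms(1)] by simp
  also have "\<dots> = V * B * W"
    using assoc_mult_mat[OF assms(1,3) W(1)] assms(5) by simp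
  finally have "similar_mat_wit A B V W"
    using W assms(1-3) by (intro similar_mat_witI[of _ _ n])
  then show ?thesis by (auto simp: similar_mat_def)
qed

section \<open>The polynomial with roots \<alpha>^m over \<int>[x, s]\<close>

text \<open>The entries of \<open>companion k\<close> lie in \<int>[x, s], hence so do these
  coefficients; this supplies the existence behind the \<open>THE\<close> in
  \<open>e_poly\<close>.\<close>

definition power_char_poly :: "nat \<Rightarrow> nat \<Rightarrow> int_xs poly" where
  "power_char_poly k m = char_poly (companion k ^\<^sub>m m)"

lemma power_char_poly_roots:
  assumes "k \<ge> 2"
  shows "map_poly emb (power_char_poly k m) = (\<Prod>\<alpha>\<in>#alphas k. [:-(\<alpha> ^ m), 1:])"
proof -
  obtain as where as: "mset as = alphas k" "length as = k" "distinct as"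
    "\<And>i. i < k \<Longrightarrow> (as ! i) ^ k = emb var_x * (as ! i) ^ (k - 1) + emb var_s"
    using distinct_roots_list[OF assms] by blast
  let ?C = "map_mat emb (companion k)" and ?bs = "map (\<lambda>a. a ^ m) as"
  have C: "?C \<in> carrier_mat k k" by simp
  have D: "diagonal ?bs \<in> carrier_mat k k" using diagonal_carrier[of ?bs] as(2) by simp
  have "map_poly emb (power_char_poly k m) = char_poly (map_mat emb (companion k ^\<^sub>m m))"
    unfolding power_char_poly_def by (rule emb.char_poly_hom[symmetric, of _ k]) simp
  also have "map_mat emb (companion k ^\<^sub>m m) = ?C ^\<^sub>m m"
    by (rule emb.mat_hom_pow) (rule companion_carrier)
  also have "char_poly (?C ^\<^sub>m m) = char_poly (diagonal ?bs)"
  proof (rule char_poly_similar, rule similar_matI_intertwined)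
    show "?C ^\<^sub>m m * vandermonde as = vandermonde as * diagonal ?bs"
      using C as by (intro pow_mat_vandermonde companion_vandermonde assms) auto
    show "det (vandermonde as) \<noteq> 0" using as(3) by (rule det_vandermonde_nonzero)
    show "vandermonde as \<in> carrier_mat k k" using vandermonde_carrier[of as] as(2) by simp
  qed (use C D in auto)
  also have "\<dots> = (\<Prod>a\<leftarrow>diag_mat (diagonal ?bs). [:-a, 1:])"
    by (rule char_poly_upper_triangular[OF D]) (auto simp: diagonal_def upper_triangular_def)
  also have "diag_mat (diagonal ?bs) = ?bs"
    by (rule nth_equalityI) (auto simp: diag_mat_def diagonal_def)
  also have "(\<Prod>a\<leftarrow>?bs. [:-a, 1:]) = (\<Prod>\<alpha>\<in>#mset as. [:-(\<alpha> ^ m), 1:])"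
    by (simp flip: prod_mset_prod_list add: o_def)
  finally show ?thesis unfolding as(1) .
qed

lemma power_char_poly_monic:
  shows "Polynomial.degree (power_char_poly k m) = k" "Polynomial.coeff (power_char_poly k m) k = 1"
  using degree_monic_char_poly[of "companion k ^\<^sub>m m" k] by (auto simp: power_char_poly_def)

text \<open>The sign \<open>(-1) ^ i\<close> is its own inverse and \<open>emb\<close> is injective,
  so the defining equation has exactly this solution.\<close>

lemma e_poly_eq:
  assumes "k \<ge> 2"
  shows "e_poly i k m = (-1) ^ i * Polynomial.coeff (power_char_poly k m) (k - i)"
proof -
  have "(-1) ^ i * emb e = Polynomial.coeff (map_poly emb (power_char_poly k m)) (k - i)
      \<longleftrightarrow> e = (-1) ^ i * Polynomial.coeff (power_char_poly k m) (k - i)" for e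
  proof -
    have "(-1) ^ i * emb e = emb c \<longleftrightarrow> e = (-1) ^ i * c" for c
    proof -
      have "(-1) ^ i * emb e = emb ((-1) ^ i * e)" by (simp add: hom_distribs)
      then show ?thesis by (cases "even i") auto
    qed
    then show ?thesis by simp
  qed
  then show ?thesis by (simp add: e_poly_def flip: power_char_poly_roots[OF assms])
qed

lemma p_poly_eq:
  assumes "k \<ge> 2"
  shows "p_poly i m k = - Polynomial.coeff (power_char_poly k m) (k - i)"
  unfolding p_poly_def e_poly_eq[OF assms] by (cases "even i") auto

lemma poly_prod_linear_factors_0:
  "poly (\<Prod>a\<in>#A. [:-(a ^ m), 1:]) 0 = (-1) ^ size A * (\<Prod>a\<in>#A. a :: 'a :: comm_ring_1) ^ m"
  by (induction A) (simp_all add: power_mult_distrib algebra_simps)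

text \<open>The constant term \<open>- var_s\<close> of the trinomial gives the product of the roots
  as \<open>(-1) ^ Suc k * var_s\<close>; its \<open>m\<close>-th power is the product of the
  \<alpha>^m.\<close>

lemma power_char_poly_const:
  assumes "k \<ge> 2"
  shows "Polynomial.coeff (power_char_poly k m) 0 = (-1) ^ k * ((-1) ^ Suc k * var_s) ^ m"
proof -
  let ?P = "\<Prod>\<alpha>\<in>#alphas k. \<alpha>"
  have "emb (Polynomial.coeff (trinomial k) 0) = (-1) ^ k * ?P"
    using poly_prod_linear_factors_0[of 1 "alphas k"] prod_alphas[OF assms]
    by (simp add: poly_0_coeff_0)
  moreover have "Polynomial.coeff (trinomial k) 0 = - var_s"
    using assms by (simp add: trinomial_def)
  ultimately have "?P = (-1) ^ k * (- emb var_s)"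
    by (cases "even k") (simp_all add: hom_distribs)
  then have P: "?P = emb ((-1) ^ Suc k * var_s)" by (simp add: hom_distribs)
  have "emb (Polynomial.coeff (power_char_poly k m) 0)
      = poly (\<Prod>\<alpha>\<in>#alphas k. [:-(\<alpha> ^ m), 1:]) 0"
    by (simp flip: power_char_poly_roots[OF assms] add: poly_0_coeff_0)
  also have "\<dots> = (-1) ^ k * ?P ^ m"
    by (simp only: poly_prod_linear_factors_0 prod_alphas(2)[OF assms])
  also have "\<dots> = emb ((-1) ^ k * ((-1) ^ Suc k * var_s) ^ m)"
    unfolding P by (simp add: hom_distribs)
  finally show ?thesis by (simp only: emb.eq_iff)
qed

section \<open>Divisibility by the trinomial\<close>

text \<open>Factor by factor, since \<open>a\<close> is a root of \<open>w^m - a^m\<close>.\<close>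

lemma prod_linear_factors_dvd_pcompose:
  fixes A :: "'a :: idom multiset"
  shows "(\<Prod>a\<in>#A. [:-a, 1:]) dvd pcompose (\<Prod>a\<in>#A. [:-(a ^ m), 1:]) (Polynomial.monom 1 m)"
proof (induction A)
  case (add a A)
  have "[:-a, 1:] dvd pcompose [:-(a ^ m), 1:] (Polynomial.monom 1 m)"
    by (simp add: poly_eq_0_iff_dvd[symmetric] poly_pcompose poly_monom)
  from mult_dvd_mono[OF this add.IH] show ?case
    by (simp only: image_mset_add_mset prod_mset.add_mset pcompose_mult)
qed simp

text \<open>The divisibility holds over the algebraic closure and descends to \<int>[x, s] because
  the trinomial is monic.\<close>

lemma trinomial_dvd_power_char_poly:
  assumes "k \<ge> 2"
  shows "trinomial k dvd pcompose (power_char_poly k m) (Polynomial.monom 1 m)"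
proof -
  let ?G = "pcompose (power_char_poly k m) (Polynomial.monom 1 m)"
  have "map_poly emb ?G = pcompose (map_poly emb (power_char_poly k m)) (Polynomial.monom 1 m)"
    by (simp add: emb.map_poly_pcompose)
  then have dvd: "map_poly emb (trinomial k) dvd map_poly emb ?G"
    unfolding power_char_poly_roots[OF assms] prod_alphas(1)[OF assms, symmetric]
    by (simp only: prod_linear_factors_dvd_pcompose)
  \<comment> \<open>For a monic divisor, pseudo-division is genuine division. Over the closure the
    trinomial divides the remainder, whose degree is too small unless it is zero.\<close>
  obtain q r where qr: "pseudo_divmod ?G (trinomial k) = (q, r)" by fastforce
  have nz: "trinomial k \<noteq> 0" using degree_trinomial[OF assms] by auto
  have G: "?G = trinomial k * q + r" and r: "r = 0 \<or> Polynomial.degree r < k"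
    using pseudo_divmod[OF nz qr] degree_trinomial[OF assms] by auto
  have "map_poly emb ?G = map_poly emb (trinomial k) * map_poly emb q + map_poly emb r"
    unfolding G by (simp add: hom_distribs)
  with dvd have "map_poly emb (trinomial k) dvd map_poly emb r"
    by (metis dvd_add_right_iff dvd_triv_left)
  then have "r = 0"
    using r degree_trinomial(1)[OF assms] by (auto dest!: dvd_imp_degree_le)
  with G show ?thesis by simp
qed

section \<open>Specialisation at \<open>s = -1\<close> and conclusion\<close>

lemma act2_trinomial_A_seq:
  assumes "k \<ge> 2" "m \<ge> 1"
  shows "act2 (map_poly (\<lambda>p. subst_s p (-1)) (trinomial k)) (\<lambda>n j. A_seq k m j z n) n j = 0"
proof -
  interpret subst: comm_ring_hom "\<lambda>p. subst_s p (-1)" by (rule ring_hom_subst_s)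
  interpret subst_poly: map_poly_comm_ring_hom "\<lambda>p. subst_s p (-1)" ..
  have x: "subst_s var_x (-1) = [:0, 1:]" and s: "subst_s var_s (-1) = -1"
    by (simp_all add: subst_s_def var_x_def var_s_def map_poly_pCons one_pCons)
  have "map_poly (\<lambda>p. subst_s p (-1)) (trinomial k)
      = Polynomial.monom 1 k - Polynomial.monom [:0, 1:] (k - 1) + [:1:]"
    by (simp add: trinomial_def hom_distribs x s)
  also have "\<dots> = Polynomial.monom 1 k + Polynomial.monom [:0, -1:] (k - 1) + Polynomial.monom 1 0"
    by (simp add: diff_conv_add_uminus minus_monom monom_0)
  finally have S: "map_poly (\<lambda>p. subst_s p (-1)) (trinomial k)
      = Polynomial.monom 1 k + Polynomial.monom [:0, -1:] (k - 1) + Polynomial.monom 1 0" .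
  have "j + int (k - 1) + 1 = j + int k" "j + int (k - 1) + 1 - int k = j"
    using assms(1) by auto
  \<comment> \<open>The offset \<open>k - 1\<close> matches the middle term of the trinomial, which
    carries the shift in \<open>n\<close>; the outer terms then sit at \<open>j + k\<close> and
    \<open>j\<close>.\<close>
  with A_seq_Suc[of k m "j + int (k - 1)" z n] assms
  have "A_seq k m (j + int (k - 1)) z (Suc n) = A_seq k m (j + int k) z n + A_seq k m j z n"
    by auto
  moreover have "apply_shift_poly 1 g n = g n" for g :: "nat \<Rightarrow> complex"
    by (simp add: one_pCons)
  ultimately show ?thesis
    unfolding S act2_add act2_monom by simp
qed

text \<open>Multiplying the value at \<open>1/z\<close> by \<open>z^k\<close> reverses the
  coefficients: the leading one gives the summand 1, the constant one gives the \<open>z^k\<close>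
  term, and those in between give the \<open>p_poly\<close> terms.\<close>

lemma p_mkz_eq:
  assumes "k \<ge> 2" "m \<ge> 1" "z \<noteq> 0"
  shows "p_mkz m k z = Polynomial.smult (z ^ k)
    (poly (map_poly (\<lambda>p. subst_s p (-1)) (power_char_poly k m)) [:inverse z:])"
proof -
  interpret subst: comm_ring_hom "\<lambda>p. subst_s p (-1)" by (rule ring_hom_subst_s)
  define c where "c i = subst_s (Polynomial.coeff (power_char_poly k m) i) (-1)" for i
  let ?P = "map_poly (\<lambda>p. subst_s p (-1)) (power_char_poly k m)"
  have coeff: "Polynomial.coeff ?P i = c i" for i by (simp add: c_def coeff_map_poly)
  have ck: "c k = 1" by (simp add: c_def power_char_poly_monic)
  have "Polynomial.degree ?P \<le> k"
    using degree_map_poly_le power_char_poly_monic(1) by metis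
  moreover have "k \<le> Polynomial.degree ?P" 
  proof (rule le_degree)
    show "Polynomial.coeff ?P k \<noteq> 0" unfolding coeff ck by simp
  qed
  ultimately have deg: "Polynomial.degree ?P = k" by simp
  have s: "subst_s var_s (-1) = -1"
    by (simp add: subst_s_def var_s_def map_poly_pCons one_pCons)
  have "c 0 = (-1) ^ k * ((-1) ^ Suc k * (-1)) ^ m"
    by (simp add: c_def power_char_poly_const[OF assms(1)] hom_distribs s)
  \<comment> \<open>The exponent is \<open>k * (m + 1)\<close> up to parity;
    \<open>m \<ge> 1\<close> is what makes the truncated \<open>m - 1\<close> have the parity of
    \<open>m + 1\<close>.\<close>
  also have "\<dots> = (-1) ^ (k * (m - 1))"
    unfolding power_mult using assms(2) by (cases m; cases "even k") auto
  finally have c0: "c 0 = (-1) ^ (k * (m - 1))" .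
  have "Polynomial.smult (z ^ k) (poly ?P [:inverse z:])
      = (\<Sum>i\<le>k. Polynomial.smult (z ^ k) (c i * [:inverse z:] ^ i))"
    by (simp only: poly_altdef deg coeff smult_sum2)
  also have "\<dots> = (\<Sum>i\<le>k. Polynomial.smult (z ^ (k - i)) (c i))"
    using assms(3) by (intro sum.cong) (auto simp: poly_const_pow power_diff field_simps)
  also have "\<dots> = (\<Sum>i\<le>k. Polynomial.smult (z ^ i) (c (k - i)))"
    by (rule sum.reindex_bij_witness[of _ "\<lambda>i. k - i" "\<lambda>i. k - i"]) auto
  also have "{..k} = insert 0 (insert k {1..k - 1})" using assms(1) by auto
  also have "(\<Sum>i\<in>insert 0 (insert k {1..k - 1}). Polynomial.smult (z ^ i) (c (k - i)))
      = 1 + (Polynomial.smult (z ^ k) (c 0) + (\<Sum>i = 1..k - 1. Polynomial.smult (z ^ i) (c (k - i))))"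
    using assms(1) by (simp add: ck)
  also have "(\<Sum>i = 1..k - 1. Polynomial.smult (z ^ i) (c (k - i)))
      = - (\<Sum>i = 1..k - 1. Polynomial.smult (z ^ i) (subst_s (p_poly i m k) (-1)))"
    by (simp add: p_poly_eq[OF assms(1)] subst.hom_uminus c_def sum_negf)
  also have "Polynomial.smult (z ^ k) (c 0) = [:(-1) ^ (k * (m - 1)) * z ^ k:]"
  proof -
    have "(-1) ^ i = [:(-1) ^ i :: complex:]" for i by (cases "even i") (auto simp: one_pCons)
    then show ?thesis by (simp add: c0)
  qed
  finally show ?thesis by (simp add: p_mkz_def one_pCons)
qed

theorem theorem3:
  fixes k m :: nat and l :: int and z :: complex
  assumes "k \<ge> 2" and "m \<ge> 1" and "z \<noteq> 0"
  shows "is_char_poly (p_mkz m k z) (A_seq k m l z)"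
  unfolding is_char_poly_def
proof
  fix n
  interpret subst: comm_ring_hom "\<lambda>p. subst_s p (-1)" by (rule ring_hom_subst_s)
  interpret subst_poly: map_poly_comm_ring_hom "\<lambda>p. subst_s p (-1)" ..
  let ?S = "map_poly (\<lambda>p. subst_s p (-1))" and ?A = "\<lambda>n j. A_seq k m j z n"
  have "?S (trinomial k) dvd ?S (pcompose (power_char_poly k m) (Polynomial.monom 1 m))"
    by (intro subst_poly.hom_dvd trinomial_dvd_power_char_poly assms)
  then have "act2 (?S (pcompose (power_char_poly k m) (Polynomial.monom 1 m))) ?A n l = 0"
    by (rule act2_dvd_zero) (intro act2_trinomial_A_seq assms)
  \<comment> \<open>Specialising \<open>s\<close> commutes with substituting \<open>w^m\<close>, so
    the outer variable can next be replaced by the factor \<open>1/z\<close> by which the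
    \<open>m\<close>-fold shift in \<open>l\<close> acts.\<close>
  then have "act2 (pcompose (?S (power_char_poly k m)) (Polynomial.monom 1 m)) ?A n l = 0"
    by (simp add: subst.map_poly_pcompose)
  then have "apply_shift_poly (poly (?S (power_char_poly k m)) [:inverse z:]) (\<lambda>n. ?A n l) n = 0"
    using assms by (subst (asm) act2_pcompose_periodic[where y = "inverse z"])
      (auto intro: A_seq_periodic)
  then show "apply_shift_poly (p_mkz m k z) (A_seq k m l z) n = 0"
    by (simp add: p_mkz_eq[OF assms] apply_shift_poly_smult)
qed

end
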